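(* There is a universal constant $c_0>0$ such that for every integer $k\ge 2$ and every $\varepsilon\in(0,1)$ there exists a finite dataset $P\subset\mathbb{R}$ such that every $\varepsilon$-coreset $S$ of $P$ for $k$-Median in $\mathbb{R}$ has size $|S|\ge c_0\,k\,\varepsilon^{-1}$ (i.e. $|S|\ge\Omega(k\varepsilon^{-1})$).
   Context: For a finite $P\subset\mathbb{R}$ and a set $C\subset\mathbb{R}$ of $k$ centers, the $k$-Median cost is $\mathrm{cost}(P,C)=\sum_{p\in P}\min_{c\in C}|p-c|$. An $\varepsilon$-coreset of $P$ for $k$-Median is a subset $S\subseteq P$ with a weight function $w:S\to\mathbb{R}_{\ge 0}$ such that for every $C\subset\mathbb{R}$ with $|C|=k$, $$(1-\varepsilon)\,\mathrm{cost}(P,C)\le\sum_{p\in S}w(p)\min_{c\in C}|p-c|\le(1+\varepsilon)\,\mathrm{cost}(P,C).$$ Its size is $|S|$. *)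

theory Defs
  imports Complex_Main
begin

text \<open>Distance from a point to its nearest center; meaningful for finite nonempty \<open>C\<close>.\<close>

definition center_dist :: "real \<Rightarrow> real set \<Rightarrow> real" where
  "center_dist p C = Min ((\<lambda>c. \<bar>p - c\<bar>) ` C)"

definition kmedian_cost :: "real set \<Rightarrow> real set \<Rightarrow> real" where
  "kmedian_cost P C = (\<Sum>p\<in>P. center_dist p C)"

definition weighted_kmedian_cost :: "real set \<Rightarrow> (real \<Rightarrow> real) \<Rightarrow> real set \<Rightarrow> real" where
  "weighted_kmedian_cost S w C = (\<Sum>p\<in>S. w p * center_dist p C)"

text \<open>The weight function is total on the reals, but only its values on \<open>S\<close> matter.\<close>

definition kmedian_coreset ::
    "nat \<Rightarrow> real \<Rightarrow> real set \<Rightarrow> real set \<Rightarrow> (real \<Rightarrow> real) \<Rightarrow> bool" where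
  "kmedian_coreset k \<epsilon> P S w \<longleftrightarrow>
     S \<subseteq> P \<and> (\<forall>p\<in>S. 0 \<le> w p) \<and>
     (\<forall>C :: real set. finite C \<and> card C = k \<longrightarrow>
        (1 - \<epsilon>) * kmedian_cost P C \<le> weighted_kmedian_cost S w C \<and>
        weighted_kmedian_cost S w C \<le> (1 + \<epsilon>) * kmedian_cost P C)"

end

theory Submission
  imports Defs
begin

text \<open>
  A point at distance about \<open>8 ^ i\<close> from the origin is given multiplicity \<open>8 ^ (N - i)\<close>, realised
  by a narrow cluster, so that with a center at \<open>0\<close> each of the \<open>N\<close> scales costs about \<open>8 ^ N\<close>.
  Suppose a coreset misses the clusters with index in a set \<open>J\<close> of size \<open>k - 1\<close>, and use the
  centers \<open>0\<close> and \<open>t * 8 ^ j\<close> for \<open>j \<in> J\<close>, with \<open>1/2 \<le> t \<le> 3/2\<close>. A point outside the missed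
  clusters is always served by the same center, which lies to its left, so the coreset cost is affine in \<open>t\<close>.
  A missed cluster, on the other hand, contributes a multiple of about \<open>\<bar>1 - t\<bar> * 8 ^ N\<close>
  to the true cost. Comparing \<open>t = 1/2, 1, 3/2\<close> thus shows an error of order \<open>(k - 1) * 8 ^ N\<close>,
  while an \<open>\<epsilon>\<close>-coreset errs by at most the order of \<open>\<epsilon> * N * 8 ^ N\<close>. This is contradictory for \<open>N\<close> a small
  multiple of \<open>k / \<epsilon>\<close>. For \<open>\<epsilon>\<close> bounded away from \<open>0\<close> it is enough that \<open>k\<close> centers can cover any
  \<open>k\<close> coreset points at cost zero.
\<close>

section \<open>Nearest-center distances and the bound for large \<epsilon>\<close>

lemma center_dist_le:
  assumes "finite C" "c \<in> C"
  shows "center_dist p C \<le> \<bar>p - c\<bar>"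
  using assms by (simp add: center_dist_def)

lemma center_dist_ge:
  assumes "finite C" "C \<noteq> {}" "\<And>c. c \<in> C \<Longrightarrow> d \<le> \<bar>p - c\<bar>"
  shows "d \<le> center_dist p C"
  using assms by (simp add: center_dist_def)

lemma center_dist_eqI:
  assumes "finite C" "c \<in> C" "\<And>c'. c' \<in> C \<Longrightarrow> \<bar>p - c\<bar> \<le> \<bar>p - c'\<bar>"
  shows "center_dist p C = \<bar>p - c\<bar>"
  using assms by (intro antisym center_dist_le center_dist_ge) auto

lemma center_dist_eq_0_iff:
  assumes "finite C" "C \<noteq> {}"
  shows "center_dist p C = 0 \<longleftrightarrow> p \<in> C"
proof
  assume "center_dist p C = 0"
  then have "0 \<in> (\<lambda>c. \<bar>p - c\<bar>) ` C"
    using Min_in[of "(\<lambda>c. \<bar>p - c\<bar>) ` C"] assms by (simp add: center_dist_def)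
  then show "p \<in> C" by auto
next
  assume "p \<in> C"
  then show "center_dist p C = 0"
    using center_dist_eqI[OF assms(1), of p p] by simp
qed

lemma coreset_card_gt:
  assumes cs: "kmedian_coreset k \<epsilon> P S w" and P: "finite P" "k < card P" and "0 < k" "\<epsilon> < 1"
  shows "k < card S"
proof (rule ccontr)
  assume "\<not> k < card S"
  have "S \<subseteq> P" using cs by (simp add: kmedian_coreset_def)
  \<comment> \<open>The coreset inequalities cover only sets of exactly \<open>k\<close> centers, so
    \<open>S\<close> is padded with further points of \<open>P\<close>.\<close>
  then obtain C where C: "S \<subseteq> C" "C \<subseteq> P" "card C = k"
    using \<open>\<not> k < card S\<close> P exists_subset_between[of S k P] by auto
  have fin: "finite C" "C \<noteq> {}"
    using C \<open>0 < k\<close> P finite_subset by auto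
  have "weighted_kmedian_cost S w C = 0"
    using C(1) center_dist_eq_0_iff[OF fin] unfolding weighted_kmedian_cost_def
    by (intro sum.neutral) auto
  then have "(1 - \<epsilon>) * kmedian_cost P C \<le> 0"
    using cs C(3) fin by (force simp: kmedian_coreset_def)
  then have le: "kmedian_cost P C \<le> 0"
    using \<open>\<epsilon> < 1\<close> by (simp add: mult_le_0_iff)
  have nonneg: "0 \<le> center_dist p C" for p
    using fin by (intro center_dist_ge) auto
  then have "kmedian_cost P C = 0"
    using le sum_nonneg[of P "\<lambda>p. center_dist p C"] by (simp add: kmedian_cost_def)
  then have "\<forall>p\<in>P. center_dist p C = 0"
    using nonneg P(1) by (simp add: kmedian_cost_def sum_nonneg_eq_0_iff)
  then have "P \<subseteq> C"
    using center_dist_eq_0_iff[OF fin] by auto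
  then show False
    using card_mono[OF fin(1)] C(3) P(2) by (simp add: leD)
qed

section \<open>Centers at a common multiple of powers of 8\<close>

definition scaled_centers :: "nat set \<Rightarrow> real \<Rightarrow> real set" where
  "scaled_centers J t = insert 0 ((\<lambda>j. t * 8 ^ j) ` J)"

lemma finite_scaled_centers [simp]: "finite J \<Longrightarrow> finite (scaled_centers J t)"
  by (simp add: scaled_centers_def)

lemma scaled_centers_nonempty [simp]: "scaled_centers J t \<noteq> {}"
  by (simp add: scaled_centers_def)

lemma card_scaled_centers:
  assumes "finite J" "t \<noteq> 0"
  shows "card (scaled_centers J t) = Suc (card J)"
proof -
  have "inj_on (\<lambda>j. t * 8 ^ j) J"
    using assms by (auto simp: inj_on_def)
  moreover have "0 \<notin> (\<lambda>j. t * 8 ^ j) ` J"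
    using assms by auto
  ultimately show ?thesis
    using assms by (simp add: scaled_centers_def card_image)
qed

lemma pow8_less:
  assumes "j < i"
  shows "8 * 8 ^ j \<le> (8::real) ^ i"
  using power_increasing[of "Suc j" i "8::real"] assms by simp

text \<open>The center serving \<open>p\<close> is \<open>t\<close> times the largest \<open>8 ^ j\<close> with \<open>j \<in> J\<close>, \<open>j < i\<close> (or \<open>0\<close>),
  so it does not depend on \<open>t\<close> except through that factor.\<close>

lemma center_dist_scaled_affine:
  fixes i :: nat
  assumes J: "finite J" "i \<notin> J" and p: "8 ^ i \<le> p" "p \<le> 9 / 8 * 8 ^ i"
  obtains b where "\<And>t. 1/2 \<le> t \<Longrightarrow> t \<le> 3/2 \<Longrightarrow> center_dist p (scaled_centers J t) = p - t * b"
proof -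
  define B where "B = insert (0::real) ((\<lambda>j. 8 ^ j) ` {j\<in>J. j < i})"
  have B: "finite B" "B \<noteq> {}" using J by (auto simp: B_def)
  define b where "b = Max B"
  have b_in: "b \<in> B" and b_max: "\<And>x. x \<in> B \<Longrightarrow> x \<le> b"
    using B by (auto simp: b_def)
  have "0 \<le> b" using b_max[of 0] by (simp add: B_def)
  have b_le: "8 * b \<le> 8 ^ i"
    using b_in pow8_less[of _ i] by (auto simp: B_def)
  have "center_dist p (scaled_centers J t) = p - t * b" if t: "1/2 \<le> t" "t \<le> 3/2" for t
  proof -
    have "t * b \<le> 3/2 * b" using t \<open>0 \<le> b\<close> by (intro mult_right_mono) auto
    then have tb: "t * b \<le> p" using b_le p \<open>0 \<le> b\<close> by linarith
    have tb0: "0 \<le> t * b" using t \<open>0 \<le> b\<close> by simp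
    have "\<bar>p - t * b\<bar> \<le> \<bar>p - c\<bar>" if c: "c \<in> scaled_centers J t" for c
    proof (cases "c \<le> t * b")
      case True
      then show ?thesis using tb by simp
    next
      case False
      then obtain j where j: "j \<in> J" "c = t * 8 ^ j"
        using c tb0 by (auto simp: scaled_centers_def)
      have "\<not> j < i"
      proof
        assume "j < i"
        then have "8 ^ j \<le> b" using j b_max by (auto simp: B_def)
        then have "c \<le> t * b" using j t by (simp add: mult_left_mono)
        then show False using False by simp
      qed
      then have "i < j" using j J by (metis linorder_neqE_nat)
      then have "8 * 8 ^ i \<le> (8::real) ^ j" by (rule pow8_less)
      moreover have "1/2 * 8 ^ j \<le> c" using j t by (simp add: mult_right_mono)
      ultimately have "4 * 8 ^ i \<le> c" by simp
      \<comment> \<open>Here \<open>c > 2 * p\<close>, so \<open>c\<close> is farther from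
        \<open>p\<close> than \<open>0\<close> is, while \<open>t * b\<close> lies between
        \<open>0\<close> and \<open>p\<close>.\<close>
      then show ?thesis using p tb tb0 by simp
    qed
    then have "center_dist p (scaled_centers J t) = \<bar>p - t * b\<bar>"
      using J b_in by (intro center_dist_eqI) (auto simp: scaled_centers_def B_def)
    then show ?thesis using tb by simp
  qed
  then show ?thesis using that by blast
qed

text \<open>The tight case is \<open>j = i\<close>, \<open>t = 3/2\<close>: the center exceeds the
  right end of the cluster by \<open>(3/2 - 9/8) * 8 ^ i\<close>. Centers of other scales are
  farther away.\<close>

lemma center_dist_scaled_ge:
  fixes i :: nat
  assumes J: "finite J" and p: "8 ^ i \<le> p" "p \<le> 9 / 8 * 8 ^ i" and t: "t = 1/2 \<or> t = 3/2"
  shows "3/8 * 8 ^ i \<le> center_dist p (scaled_centers J t)"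
proof (rule center_dist_ge)
  fix c assume "c \<in> scaled_centers J t"
  then consider "c = 0" | j where "c = t * 8 ^ j"
    by (auto simp: scaled_centers_def)
  then show "3/8 * 8 ^ i \<le> \<bar>p - c\<bar>"
  proof cases
    case 1
    then show ?thesis using p by simp
  next
    case 2
    then have c: "c = 1/2 * 8 ^ j \<or> c = 3/2 * 8 ^ j" using t by auto
    have pos: "0 < (8::real) ^ i" "0 < (8::real) ^ j" by auto
    consider "j < i" | "j = i" | "i < j" by linarith
    then show ?thesis
    proof cases
      case 1
      then show ?thesis using pow8_less[of j i] c p pos by linarith
    next
      case 2
      then show ?thesis using c p pos by auto
    next
      case 3
      then show ?thesis using pow8_less[of i j] c p pos by linarith
    qed
  qed
qed (use J in auto)

section \<open>The clustered dataset\<close>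

lemma exists_clusters:
  fixes lo hi :: "nat \<Rightarrow> real" and n :: "nat \<Rightarrow> nat"
  assumes "\<And>i. lo i < hi i"
  obtains A where "\<And>i. finite (A i)" "\<And>i. card (A i) = n i" "\<And>i. A i \<subseteq> {lo i..hi i}"
proof -
  have "\<exists>B. finite B \<and> card B = n i \<and> B \<subseteq> {lo i..hi i}" for i
    using infinite_arbitrarily_large[of "{lo i..hi i}" "n i"] assms[of i]
    by (simp add: infinite_Icc_iff)
  then show ?thesis using that by metis
qed

locale geometric_clusters =
  fixes N :: nat and A :: "nat \<Rightarrow> real set"
  assumes fin: "finite (A i)"
    and crd: "card (A i) = 8 ^ (N - i)"
    and sub: "A i \<subseteq> {8 ^ i .. 9 / 8 * 8 ^ i}"
begin

definition points :: "real set" where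
  "points = (\<Union>i<N. A i)"

lemma finite_points: "finite points"
  by (simp add: points_def fin)

lemma bounds:
  assumes "p \<in> A i"
  shows "8 ^ i \<le> p" "p \<le> 9 / 8 * 8 ^ i"
  using sub[of i] assms by auto

lemma disjoint:
  assumes "i \<noteq> j"
  shows "A i \<inter> A j = {}"
proof -
  have "A i \<inter> A j = {}" if "i < j" for i j
  proof -
    have "8 * 8 ^ i \<le> (8::real) ^ j" using that by (rule pow8_less)
    moreover have "0 < (8::real) ^ i" by simp
    ultimately have "9 / 8 * 8 ^ i < (8::real) ^ j" by linarith
    then show ?thesis using bounds by fastforce
  qed
  then show ?thesis using assms by (metis Int_commute linorder_neqE_nat)
qed

lemma cost_points: "kmedian_cost points C = (\<Sum>i<N. \<Sum>p\<in>A i. center_dist p C)"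
  unfolding kmedian_cost_def points_def
  by (rule sum.UNION_disjoint) (use fin disjoint in auto)

lemma cluster_mass:
  assumes "i < N"
  shows "real (card (A i)) * (c * 8 ^ i) = c * 8 ^ N"
proof -
  have "8 ^ (N - i) * 8 ^ i = (8::real) ^ N"
    using assms by (simp flip: power_add)
  then show ?thesis by (simp add: crd mult.left_commute)
qed

lemma cost_scaled_le:
  assumes "finite J"
  shows "kmedian_cost points (scaled_centers J t) \<le> 9/8 * real N * 8 ^ N"
proof -
  have "(\<Sum>p\<in>A i. center_dist p (scaled_centers J t)) \<le> 9/8 * 8 ^ N" if "i < N" for i
  proof -
    have "center_dist p (scaled_centers J t) \<le> 9/8 * 8 ^ i" if "p \<in> A i" for p
    proof -
      have "0 \<le> p" using bounds[OF that] zero_le_power[of "8::real" i] by linarith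
      then show ?thesis
        using center_dist_le[of "scaled_centers J t" 0 p] assms bounds[OF that]
        by (simp add: scaled_centers_def)
    qed
    then have "(\<Sum>p\<in>A i. center_dist p (scaled_centers J t)) \<le> real (card (A i)) * (9/8 * 8 ^ i)"
      by (rule sum_bounded_above)
    also have "\<dots> = 9/8 * 8 ^ N" using that by (rule cluster_mass)
    finally show ?thesis .
  qed
  then have "kmedian_cost points (scaled_centers J t) \<le> (\<Sum>i<N. 9/8 * 8 ^ N)"
    unfolding cost_points by (intro sum_mono) auto
  then show ?thesis by (simp add: mult.assoc mult.left_commute)
qed

text \<open>This second difference in \<open>t\<close> kills affine functions, so only missed
  clusters survive it.\<close>

abbreviation second_diff :: "nat set \<Rightarrow> real \<Rightarrow> real" where
  "second_diff J p \<equiv> center_dist p (scaled_centers J (1/2)) + center_dist p (scaled_centers J (3/2))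
     - 2 * center_dist p (scaled_centers J 1)"

lemma second_diff_hit:
  assumes "finite J" "i \<notin> J" "p \<in> A i"
  shows "second_diff J p = 0"
proof -
  obtain b where b: "\<And>t. 1/2 \<le> t \<Longrightarrow> t \<le> 3/2 \<Longrightarrow> center_dist p (scaled_centers J t) = p - t * b"
    using center_dist_scaled_affine[OF assms(1,2) bounds[OF assms(3)]] by blast
  show ?thesis using b[of "1/2"] b[of "3/2"] b[of 1] by simp
qed

text \<open>Both outer values of \<open>t\<close> cost at least \<open>3/8 * 8 ^ i\<close>, whereas
  at \<open>t = 1\<close> the center \<open>8 ^ i\<close> is within the cluster width
  \<open>1/8 * 8 ^ i\<close>; and \<open>3/8 + 3/8 - 2/8 = 1/2\<close>.\<close>

lemma second_diff_missed:
  assumes J: "finite J" "i \<in> J" and p: "p \<in> A i"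
  shows "1/2 * 8 ^ i \<le> second_diff J p"
proof -
  have "center_dist p (scaled_centers J 1) \<le> \<bar>p - 8 ^ i\<bar>"
    using J by (intro center_dist_le) (auto simp: scaled_centers_def)
  then have "center_dist p (scaled_centers J 1) \<le> 1/8 * 8 ^ i"
    using bounds[OF p] by linarith
  then show ?thesis
    using center_dist_scaled_ge[OF J(1) bounds[OF p], of "1/2"]
      center_dist_scaled_ge[OF J(1) bounds[OF p], of "3/2"] by linarith
qed

lemma missed_cost_gap:
  assumes J: "J \<subseteq> {..<N}"
  shows "1/2 * real (card J) * 8 ^ N
    \<le> kmedian_cost points (scaled_centers J (1/2)) + kmedian_cost points (scaled_centers J (3/2))
      - 2 * kmedian_cost points (scaled_centers J 1)"
proof -
  have finJ: "finite J" using J finite_subset by blast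
  have "1/2 * 8 ^ N \<le> (\<Sum>p\<in>A i. second_diff J p)" if "i \<in> J" for i
  proof -
    have "real (card (A i)) * (1/2 * 8 ^ i) \<le> (\<Sum>p\<in>A i. second_diff J p)"
      using second_diff_missed[OF finJ that] by (intro sum_bounded_below)
    then show ?thesis using cluster_mass[of i "1/2"] that J by auto
  qed
  then have "real (card J) * (1/2 * 8 ^ N) \<le> (\<Sum>i\<in>J. \<Sum>p\<in>A i. second_diff J p)"
    by (rule sum_bounded_below)
  also have "\<dots> = (\<Sum>i<N. \<Sum>p\<in>A i. second_diff J p)"
    using J second_diff_hit[OF finJ] by (intro sum.mono_neutral_left) auto
  finally show ?thesis
    by (simp add: cost_points sum.distrib sum_subtractf sum_distrib_left mult.commute)
qed

lemma coreset_misses_few: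
  assumes cs: "kmedian_coreset k \<epsilon> points S w" and "2 \<le> k" "0 < \<epsilon>"
    and small: "32 * \<epsilon> * real N \<le> real k"
  shows "card {i. i < N \<and> A i \<inter> S = {}} < k - 1"
proof (rule ccontr)
  assume "\<not> ?thesis"
  \<comment> \<open>Together with the center \<open>0\<close>, \<open>k - 1\<close> missed scales
    use up exactly \<open>k\<close> centers.\<close>
  then obtain J where J: "J \<subseteq> {i. i < N \<and> A i \<inter> S = {}}" "card J = k - 1" "finite J"
    using obtain_subset_with_card_n[of "k - 1" "{i. i < N \<and> A i \<inter> S = {}}"] by auto
  define G where "G t = kmedian_cost points (scaled_centers J t)" for t
  define H where "H t = weighted_kmedian_cost S w (scaled_centers J t)" for t
  have coreset: "(1 - \<epsilon>) * G t \<le> H t \<and> H t \<le> (1 + \<epsilon>) * G t" if "t \<noteq> 0" for t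
    using cs that J \<open>2 \<le> k\<close> card_scaled_centers[OF J(3) that]
    by (simp add: kmedian_coreset_def G_def H_def)
  have "second_diff J p = 0" if "p \<in> S" for p
  proof -
    have "p \<in> points" using cs that by (auto simp: kmedian_coreset_def)
    then obtain i where i: "p \<in> A i" by (auto simp: points_def)
    then have "i \<notin> J" using J that by auto
    then show ?thesis using i J second_diff_hit by blast
  qed
  then have "(\<Sum>p\<in>S. w p * second_diff J p) = 0" by simp
  then have affine: "H (1/2) + H (3/2) = 2 * H 1"
    by (simp add: H_def weighted_kmedian_cost_def algebra_simps sum.distrib sum_subtractf
        sum_distrib_left)
  have G_le: "\<epsilon> * G t \<le> \<epsilon> * (9/8 * real N * 8 ^ N)" for t
    unfolding G_def using \<open>0 < \<epsilon>\<close> J by (intro mult_left_mono cost_scaled_le) auto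
  have "1/2 * real (k - 1) * 8 ^ N \<le> G (1/2) + G (3/2) - 2 * G 1"
    unfolding G_def J(2)[symmetric] using J by (intro missed_cost_gap) auto
  \<comment> \<open>Lower coreset bounds at \<open>1/2\<close> and \<open>3/2\<close> and the upper
    one at \<open>1\<close> replace \<open>G\<close> by \<open>H\<close>; the \<open>H\<close> terms
    cancel by \<open>affine\<close>.\<close>
  also have "\<dots> \<le> \<epsilon> * G (1/2) + \<epsilon> * G (3/2) + 2 * (\<epsilon> * G 1)"
    using coreset[of "1/2"] coreset[of "3/2"] coreset[of 1] affine
    by (simp add: algebra_simps)
  also have "\<dots> \<le> 4 * (\<epsilon> * (9/8 * real N * 8 ^ N))"
    using G_le[of "1/2"] G_le[of "3/2"] G_le[of 1] by linarith
  also have "\<dots> = 9/2 * (\<epsilon> * real N) * 8 ^ N" by simp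
  finally have "1/2 * real (k - 1) \<le> 9/2 * (\<epsilon> * real N)"
    by (rule mult_right_le_imp_le) simp
  \<comment> \<open>With \<open>small\<close> this gives \<open>k - 1 \<le> 9/32 * k\<close>, which
    fails for \<open>k \<ge> 2\<close>.\<close>
  then show False using small \<open>2 \<le> k\<close> by (simp add: of_nat_diff)
qed

text \<open>At most \<open>k - 2\<close> clusters are missed, and the others, being disjoint, each
  need their own point of \<open>S\<close>. The additive form avoids truncated subtraction.\<close>

lemma coreset_card_ge:
  assumes cs: "kmedian_coreset k \<epsilon> points S w" and "2 \<le> k" "0 < \<epsilon>"
    and "32 * \<epsilon> * real N \<le> real k"
  shows "N + 2 \<le> card S + k"
proof -
  define M where "M = {i. i < N \<and> A i \<inter> S = {}}"
  have "finite S"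
    using cs finite_points finite_subset by (auto simp: kmedian_coreset_def)
  have "\<forall>i\<in>{..<N} - M. \<exists>p. p \<in> A i \<inter> S"
    by (auto simp: M_def)
  then obtain f where f: "\<And>i. i \<in> {..<N} - M \<Longrightarrow> f i \<in> A i \<inter> S"
    by metis
  have "inj_on f ({..<N} - M)"
  proof (rule inj_onI)
    fix i j assume "i \<in> {..<N} - M" "j \<in> {..<N} - M" "f i = f j"
    then show "i = j" using f[of i] f[of j] disjoint[of i j] by auto
  qed
  then have "card ({..<N} - M) \<le> card S"
    using f \<open>finite S\<close> by (intro card_inj_on_le) auto
  moreover have "card ({..<N} - M) = N - card M"
    by (subst card_Diff_subset) (auto simp: M_def)
  moreover have "card M < k - 1"
    unfolding M_def using assms by (rule coreset_misses_few)
  ultimately show ?thesis by linarith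
qed

end

theorem theorem2p9:
  "\<exists>c0::real. 0 < c0 \<and>
     (\<forall>(k::nat) (\<epsilon>::real). 2 \<le> k \<and> 0 < \<epsilon> \<and> \<epsilon> < 1 \<longrightarrow>
        (\<exists>P::real set. finite P \<and>
           (\<forall>S w. kmedian_coreset k \<epsilon> P S w \<longrightarrow> c0 * real k / \<epsilon> \<le> real (card S))))"
proof (intro exI[of _ "1/64"] conjI allI impI)
  fix k :: nat and \<epsilon> :: real
  assume as: "2 \<le> k \<and> 0 < \<epsilon> \<and> \<epsilon> < 1"
  show "\<exists>P::real set. finite P \<and>
    (\<forall>S w. kmedian_coreset k \<epsilon> P S w \<longrightarrow> 1/64 * real k / \<epsilon> \<le> real (card S))"
  proof (cases "\<epsilon> \<le> 1/64")
    case True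
    \<comment> \<open>The largest \<open>N\<close> for which \<open>coreset_card_ge\<close> applies.
      It is about twice the target \<open>k / (64 * \<epsilon>)\<close>; as
      \<open>\<epsilon> \<le> 1/64\<close>, one of the two copies absorbs the loss of
      \<open>k\<close>.\<close>
    define N where "N = nat \<lfloor>real k / (32 * \<epsilon>)\<rfloor>"
    have N: "real N \<le> real k / (32 * \<epsilon>)" "real k / (32 * \<epsilon>) < real N + 1"
      using as by (auto simp: N_def)
    obtain A where "\<And>i. finite (A i)" "\<And>i. card (A i) = 8 ^ (N - i)"
      "\<And>i. A i \<subseteq> {8 ^ i .. 9 / 8 * (8::real) ^ i}"
      using exists_clusters[of "\<lambda>i. 8 ^ i" "\<lambda>i. 9 / 8 * 8 ^ i" "\<lambda>i. 8 ^ (N - i)"] by auto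
    then interpret geometric_clusters N A by unfold_locales
    have "1/64 * real k / \<epsilon> \<le> real (card S)" if cs: "kmedian_coreset k \<epsilon> points S w" for S w
    proof -
      have "32 * \<epsilon> * real N \<le> real k" using N(1) as by (simp add: field_simps)
      then have "N + 2 \<le> card S + k" using coreset_card_ge cs as by blast
      moreover have "real k \<le> 1/64 * real k / \<epsilon>"
        using as True mult_right_mono[of \<epsilon> "1/64" "real k"] by (simp add: field_simps)
      moreover have "real k / (32 * \<epsilon>) = 2 * (1/64 * real k / \<epsilon>)" by simp
      ultimately show ?thesis using N(2) by linarith
    qed
    then show ?thesis using finite_points by blast
  next
    case False
    \<comment> \<open>For \<open>\<epsilon> > 1/64\<close> the target is below \<open>k\<close>, so
      any \<open>k + 1\<close> points suffice.\<close>
    define P :: "real set" where "P = real ` {..k}"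
    have P: "finite P" "k < card P" by (auto simp: P_def card_image)
    have "1/64 * real k / \<epsilon> \<le> real (card S)" if "kmedian_coreset k \<epsilon> P S w" for S w
    proof -
      have "k < card S" using coreset_card_gt[OF that P] as by simp
      moreover have "1/64 * real k / \<epsilon> \<le> real k"
        using as False mult_right_mono[of "1/64" \<epsilon> "real k"] by (simp add: field_simps)
      ultimately show ?thesis by linarith
    qed
    then show ?thesis using P by blast
  qed
qed simp

end
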